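(* Let $P$ be a program with set of controlled inputs $\mathcal A$ and finite set of uncontrolled inputs $\mathcal X$, let $O$ be a set of finite traces, and let $\pi_1,\dots,\pi_n$ ($n\ge 1$) be paths in $P$. Then there exists $i$ with $1\le i\le n$ such that $$q(P|^{\pi_i},O)\ge\frac1n\,q(P|^{\pi_1,\dots,\pi_n},O),$$ where $P|^{\pi_1,\dots,\pi_n}$ is the restriction of $P$ to the paths $\pi_1,\dots,\pi_n$ and $q$ denotes quantitative robustness.
   Context: A program $P$ is a deterministic transition system: a set of states $\mathcal S$ with a transition relation $\to$ under which each state has at most one successor. An input of $P$ is a pair $(a,x)$ with $a\in\mathcal A$ (controlled input) and $x\in\mathcal X$ (uncontrolled input); $\mathcal A$ and $\mathcal X$ are nonempty and $\mathcal X$ is finite. Each input determines the initial state. A (finite) trace is a finite sequence of consecutive states respecting $\to$ starting from an initial state; $T(P)$ is the set of traces of $P$, and $T(P|_{(a,x)})$ is the set of traces of $P$ starting in the initial state determined by the input $(a,x)$. Each state has an associated location in the source of the program; a path is a finite sequence of locations, and a trace follows the path given by the sequence of locations of its states. For paths $\pi_1,\dots,\pi_n$, the restriction $P|^{\pi_1,\dots,\pi_n}$ of $P$ to these paths has as traces on input $(a,x)$ exactly those traces in $T(P|_{(a,x)})$ which follow one of $\pi_1,\dots,\pi_n$. Quantitative robustness of a program $P'$ (either $P$ or one of its restrictions): $$q(P',O)=\frac1{|\mathcal X|}\max_{a\in\mathcal A}\left|\left\{x\in\mathcal X\mid T(P'|_{(a,x)})\cap O\neq\varnothing\right\}\right|.$$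 *)

theory Defs
  imports Complex_Main
begin

record ('a, 'x, 's, 'l) prog =
  states :: "'s set"
  step :: "('s \<times> 's) set"
  controlled :: "'a set"
  uncontrolled :: "'x set"
  init :: "'a \<Rightarrow> 'x \<Rightarrow> 's"
  locations :: "'l set"
  loc :: "'s \<Rightarrow> 'l"

text \<open>The controlled inputs, unlike the uncontrolled ones, may be infinitely many.\<close>

locale program =
  fixes P :: "('a, 'x, 's, 'l) prog"
  assumes step_states: "step P \<subseteq> states P \<times> states P"
    and deterministic: "single_valued (step P)"
    and controlled_nonempty: "controlled P \<noteq> {}"
    and uncontrolled_nonempty: "uncontrolled P \<noteq> {}"
    and uncontrolled_finite: "finite (uncontrolled P)"
    and init_states: "\<And>a x. a \<in> controlled P \<Longrightarrow> x \<in> uncontrolled P \<Longrightarrow> init P a x \<in> states P"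
    and loc_locations: "\<And>s. s \<in> states P \<Longrightarrow> loc P s \<in> locations P"

text \<open>A trace contains at least its initial state.\<close>

definition traces_on :: "('a, 'x, 's, 'l) prog \<Rightarrow> 'a \<Rightarrow> 'x \<Rightarrow> 's list set" where
  "traces_on P a x =
    {t. t \<noteq> [] \<and> hd t = init P a x \<and> set t \<subseteq> states P \<and>
        successively (\<lambda>s s'. (s, s') \<in> step P) t}"

definition traces :: "('a, 'x, 's, 'l) prog \<Rightarrow> 's list set" where
  "traces P = (\<Union>a\<in>controlled P. \<Union>x\<in>uncontrolled P. traces_on P a x)"

definition paths :: "('a, 'x, 's, 'l) prog \<Rightarrow> 'l list set" where
  "paths P = lists (locations P)"

definition follows :: "('a, 'x, 's, 'l) prog \<Rightarrow> 's list \<Rightarrow> 'l list \<Rightarrow> bool" where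
  "follows P t \<pi> \<longleftrightarrow> map (loc P) t = \<pi>"

text \<open>
  The restriction of a program to some paths is specified only by its traces on each input, and is
  in general not given by a transition system: its trace sets need not be closed under prefixes.
  Programs and their restrictions are therefore both viewed as instances of the following type,
  which records just what robustness depends on.
\<close>

record ('a, 'x, 's) behaviour =
  controlled_inputs :: "'a set"
  uncontrolled_inputs :: "'x set"
  behaviour_traces :: "'a \<Rightarrow> 'x \<Rightarrow> 's list set"

definition unrestricted :: "('a, 'x, 's, 'l) prog \<Rightarrow> ('a, 'x, 's) behaviour" where
  "unrestricted P =
    \<lparr>controlled_inputs = controlled P,
     uncontrolled_inputs = uncontrolled P,
     behaviour_traces = traces_on P\<rparr>"

definition restriction :: "('a, 'x, 's, 'l) prog \<Rightarrow> 'l list set \<Rightarrow> ('a, 'x, 's) behaviour" where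
  "restriction P \<Pi> =
    \<lparr>controlled_inputs = controlled P,
     uncontrolled_inputs = uncontrolled P,
     behaviour_traces = (\<lambda>a x. {t \<in> traces_on P a x. \<exists>\<pi>\<in>\<Pi>. follows P t \<pi>})\<rparr>"

text \<open>
  \<^const>\<open>Max\<close> is meaningful even for infinitely many controlled inputs: the set of
  cardinalities is bounded by the number of uncontrolled inputs, hence finite.
\<close>

definition quantitative_robustness :: "('a, 'x, 's) behaviour \<Rightarrow> 's list set \<Rightarrow> real" where
  "quantitative_robustness B Obs =
    1 / real (card (uncontrolled_inputs B)) *
    real (Max ((\<lambda>a. card {x \<in> uncontrolled_inputs B. behaviour_traces B a x \<inter> Obs \<noteq> {}})
               ` controlled_inputs B))"

end

theory Submission
  imports Defs
begin

text \<open>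
  Fix a controlled input that is optimal for the restriction to all the paths. The uncontrolled
  inputs that succeed for it are covered by the \<open>n\<close> sets of those that succeed along a single
  path, so one of these sets has at least \<open>1 / n\<close> times as many elements.
\<close>

definition successful_inputs ::
  "('a, 'x, 's) behaviour \<Rightarrow> 's list set \<Rightarrow> 'a \<Rightarrow> 'x set" where
  "successful_inputs B Obs a =
    {x \<in> uncontrolled_inputs B. behaviour_traces B a x \<inter> Obs \<noteq> {}}"

lemma quantitative_robustness_eq_Max:
  "quantitative_robustness B Obs =
    1 / real (card (uncontrolled_inputs B)) *
    real (Max ((\<lambda>a. card (successful_inputs B Obs a)) ` controlled_inputs B))"
  by (simp add: quantitative_robustness_def successful_inputs_def)

text \<open>\<open>A\<close> may be infinite, so finiteness comes from the values: each is at most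
  the number of uncontrolled inputs. This is what gives \<open>Max\<close> its usual properties
  below.\<close>

lemma finite_card_successful_inputs:
  assumes "finite (uncontrolled_inputs B)"
  shows "finite ((\<lambda>a. card (successful_inputs B Obs a)) ` A)"
proof (rule finite_subset)
  show "(\<lambda>a. card (successful_inputs B Obs a)) ` A \<subseteq> {..card (uncontrolled_inputs B)}"
    using assms by (auto simp: successful_inputs_def intro!: card_mono)
qed simp

lemma quantitative_robustness_ge:
  assumes "finite (uncontrolled_inputs B)" and "a \<in> controlled_inputs B"
  shows "1 / real (card (uncontrolled_inputs B)) * real (card (successful_inputs B Obs a))
    \<le> quantitative_robustness B Obs"
  unfolding quantitative_robustness_eq_Max
  using assms finite_card_successful_inputs[OF assms(1)]
  by (intro mult_left_mono) auto

lemma quantitative_robustness_attained: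
  assumes "finite (uncontrolled_inputs B)" and "controlled_inputs B \<noteq> {}"
  obtains a where "a \<in> controlled_inputs B"
    and "quantitative_robustness B Obs =
      1 / real (card (uncontrolled_inputs B)) * real (card (successful_inputs B Obs a))"
proof -
  have "Max ((\<lambda>a. card (successful_inputs B Obs a)) ` controlled_inputs B)
      \<in> (\<lambda>a. card (successful_inputs B Obs a)) ` controlled_inputs B"
    using assms by (intro Max_in finite_card_successful_inputs) auto
  then show thesis
    using that unfolding quantitative_robustness_eq_Max by force
qed

lemma restriction_inputs [simp]:
  "controlled_inputs (restriction P \<Pi>) = controlled P"
  "uncontrolled_inputs (restriction P \<Pi>) = uncontrolled P"
  by (simp_all add: restriction_def)

text \<open>The existential over paths commutes with the one over traces in \<open>Obs\<close>. The
  union runs over indices rather than paths, so that repeated paths do no harm and the number of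
  sets is \<open>card I\<close>.\<close>

lemma successful_inputs_restriction_image:
  "successful_inputs (restriction P (\<pi> ` I)) Obs a =
    (\<Union>i\<in>I. successful_inputs (restriction P {\<pi> i}) Obs a)"
  by (auto simp: successful_inputs_def restriction_def)

text \<open>Pigeonhole: a largest \<open>A i\<close> bounds every term of the union bound. If some
  \<open>A i\<close> is infinite, so is the union, whose \<open>card\<close> is then 0.\<close>

lemma card_UN_le_mult_card:
  assumes "finite I" and "I \<noteq> {}"
  obtains i where "i \<in> I" and "card (\<Union>i\<in>I. A i) \<le> card I * card (A i)"
proof -
  have "Max ((\<lambda>i. card (A i)) ` I) \<in> (\<lambda>i. card (A i)) ` I"
    using assms by (intro Max_in) auto
  then obtain i where i: "i \<in> I" "card (A i) = Max ((\<lambda>i. card (A i)) ` I)"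
    by auto
  have "card (\<Union>i\<in>I. A i) \<le> (\<Sum>i\<in>I. card (A i))"
    using assms by (intro card_UN_le)
  \<comment> \<open>On \<open>nat\<close>, \<open>of_nat\<close> is the identity; it is written to
    match \<open>sum_bounded_above\<close>.\<close>
  also have "\<dots> \<le> of_nat (card I) * card (A i)"
    using assms i(2) by (intro sum_bounded_above) simp
  finally show thesis
    using that i(1) by simp
qed

theorem proposition4p5:
  fixes P :: "('a, 'x, 's, 'l) prog"
    and Obs :: "'s list set"
    and \<pi> :: "nat \<Rightarrow> 'l list"
    and n :: nat
  assumes "program P"
    and "Obs \<subseteq> traces P"
    and "n \<ge> 1"
    and "\<And>i. i \<in> {1..n} \<Longrightarrow> \<pi> i \<in> paths P"
  shows "\<exists>i\<in>{1..n}.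
    quantitative_robustness (restriction P {\<pi> i}) Obs
      \<ge> 1 / real n * quantitative_robustness (restriction P (\<pi> ` {1..n})) Obs"
proof -
  interpret program P by fact
  let ?S = "\<lambda>\<Pi>. successful_inputs (restriction P \<Pi>) Obs"
  let ?q = "\<lambda>\<Pi>. quantitative_robustness (restriction P \<Pi>) Obs"
  let ?c = "1 / real (card (uncontrolled P))"
  obtain a where a: "a \<in> controlled P"
    and opt: "?q (\<pi> ` {1..n}) = ?c * real (card (?S (\<pi> ` {1..n}) a))"
    using quantitative_robustness_attained[of "restriction P (\<pi> ` {1..n})" Obs]
      uncontrolled_finite controlled_nonempty by auto
  \<comment> \<open>The index is chosen for this fixed \<open>a\<close>; the factor \<open>n\<close>
    is the cardinality of \<open>{1..n}\<close>.\<close>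
  obtain i where i: "i \<in> {1..n}"
    and le: "card (?S (\<pi> ` {1..n}) a) \<le> n * card (?S {\<pi> i} a)"
    using card_UN_le_mult_card[of "{1..n}" "\<lambda>i. ?S {\<pi> i} a"] \<open>n \<ge> 1\<close>
    by (auto simp: successful_inputs_restriction_image)
  have "real (card (?S (\<pi> ` {1..n}) a)) \<le> real n * real (card (?S {\<pi> i} a))"
    using le by (metis of_nat_le_iff of_nat_mult)
  then have "1 / real n * real (card (?S (\<pi> ` {1..n}) a)) \<le> real (card (?S {\<pi> i} a))"
    using \<open>n \<ge> 1\<close> by (simp add: divide_le_eq mult.commute)
  then have "?c * (1 / real n * real (card (?S (\<pi> ` {1..n}) a))) \<le> ?c * real (card (?S {\<pi> i} a))"
    by (rule mult_left_mono) simp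
  \<comment> \<open>\<open>a\<close> need not be optimal for the single path \<pi> i, but the
    maximum over controlled inputs is at least its value at \<open>a\<close>.\<close>
  also have "\<dots> \<le> ?q {\<pi> i}"
    using quantitative_robustness_ge[of "restriction P {\<pi> i}" a Obs] uncontrolled_finite a by simp
  finally have "1 / real n * ?q (\<pi> ` {1..n}) \<le> ?q {\<pi> i}"
    unfolding opt by (simp only: mult.left_commute)
  with i show ?thesis by blast
qed

end
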